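(* $(\widetilde{\mathbb{R}}(n),\le)$ is a partially ordered ring; that is, $\le$ is a partial order (reflexive, antisymmetric, transitive) on the commutative ring $\widetilde{\mathbb{R}}(n)$ such that for all $\tilde r,\tilde s,\tilde t\in\widetilde{\mathbb{R}}(n)$: $\tilde r\le\tilde s$ implies $\tilde r+\tilde t\le\tilde s+\tilde t$, and $0\le\tilde r$, $0\le\tilde s$ imply $0\le\tilde r\tilde s$.
   Context: $n\in\mathbb{N}=\{1,2,\dots\}$. For expressions defined for small $\varepsilon>0$, $f(\varepsilon)=O(g(\varepsilon))$ means $\exists C>0\ \exists\varepsilon_0>0\ \forall\varepsilon<\varepsilon_0$: $|f(\varepsilon)|<C|g(\varepsilon)|$. $\mathcal{D}(\mathbb{R}^n)$ is the space of smooth compactly supported (complex-valued) functions. For $q\in\mathbb{N}_0$, $\mathcal{A}_q(\mathbb{R}^n)$ is the set of $\varphi\in\mathcal{D}(\mathbb{R}^n)$ with $\int\varphi=1$ and $\int x^\alpha\varphi(x)\,dx=0$ for all multi-indices $\alpha$ with $1\le|\alpha|\le q$. For $\varepsilon>0$, $(S_\varepsilon\varphi)(y):=\varepsilon^{-n}\varphi(y/\varepsilon)$. $\mathbb{R}_M(n)$ is the set of $r:\mathcal{A}_0(\mathbb{R}^n)\to\mathbb{R}$ such that $\exists N\in\mathbb{N}\ \forall\varphi\in\mathcal{A}_N(\mathbb{R}^n)$: $|r(S_\varepsilon\varphi)|=O(\varepsilon^{-N})$; $\mathbb{R}_N(n)$ is the set of $r:\mathcal{A}_0(\mathbb{R}^n)\to\mathbb{R}$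 such that $\forall m\in\mathbb{N}\ \exists q\in\mathbb{N}\ \forall\varphi\in\mathcal{A}_q(\mathbb{R}^n)$: $|r(S_\varepsilon\varphi)|=O(\varepsilon^m)$; $\widetilde{\mathbb{R}}(n):=\mathbb{R}_M(n)/\mathbb{R}_N(n)$ with pointwise operations. For $\tilde r,\tilde s\in\widetilde{\mathbb{R}}(n)$ write $\tilde r\le\tilde s$ if there are representatives $r$ of $\tilde r$ and $s$ of $\tilde s$ such that $r(\varphi)\le s(\varphi)$ for all $\varphi\in\mathcal{A}_0(\mathbb{R}^n)$. *)

theory Defs
  imports
    "HOL-Analysis.Analysis"
    "HOL-Library.Landau_Symbols"
    "HOL-Algebra.QuotRing"
begin

primrec C_k :: "nat \<Rightarrow> (real ^ 'n \<Rightarrow> complex) \<Rightarrow> bool" where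
  "C_k 0 f \<longleftrightarrow> continuous_on UNIV f"
| "C_k (Suc k) f \<longleftrightarrow> (\<forall>x. f differentiable (at x)) \<and>
     (\<forall>i. C_k k (\<lambda>x. frechet_derivative f (at x) (axis i 1)))"

definition test_functions :: "(real ^ 'n \<Rightarrow> complex) set" where
  "test_functions = {\<phi>. (\<forall>k. C_k k \<phi>) \<and> compact (closure {x. \<phi> x \<noteq> 0})}"

definition monomial :: "('n \<Rightarrow> nat) \<Rightarrow> real ^ 'n \<Rightarrow> real" where
  "monomial \<alpha> x = (\<Prod>i\<in>UNIV. (x $ i) ^ \<alpha> i)"

definition mollifiers :: "nat \<Rightarrow> (real ^ 'n \<Rightarrow> complex) set" where
  "mollifiers q = {\<phi> \<in> test_functions.
     (LINT x|lborel. \<phi> x) = 1 \<and>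
     (\<forall>\<alpha>. 1 \<le> (\<Sum>i\<in>UNIV. \<alpha> i) \<and> (\<Sum>i\<in>UNIV. \<alpha> i) \<le> q \<longrightarrow>
        (LINT x|lborel. of_real (monomial \<alpha> x) * \<phi> x) = 0)}"

definition dilation :: "real \<Rightarrow> (real ^ 'n \<Rightarrow> complex) \<Rightarrow> real ^ 'n \<Rightarrow> complex" where
  "dilation \<epsilon> \<phi> = (\<lambda>y. of_real (1 / \<epsilon> ^ CARD('n)) * \<phi> ((1 / \<epsilon>) *\<^sub>R y))"

(* O[at_right 0] is used below only with a nonvanishing comparison function; the next lemma
   shows that it then agrees with the formulation by a strict inequality on some (0, \<epsilon>0). *)
lemma bigo_at_right_0_iff:
  fixes f g :: "real \<Rightarrow> real"
  assumes "\<And>\<epsilon>. \<epsilon> > 0 \<Longrightarrow> g \<epsilon> \<noteq> 0"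
  shows "f \<in> O[at_right 0](g) \<longleftrightarrow>
    (\<exists>C>0. \<exists>\<epsilon>0>0. \<forall>\<epsilon>. 0 < \<epsilon> \<and> \<epsilon> < \<epsilon>0 \<longrightarrow> \<bar>f \<epsilon>\<bar> < C * \<bar>g \<epsilon>\<bar>)"
proof
  assume "f \<in> O[at_right 0](g)"
  then obtain c b where c: "c > 0" and b: "b > 0"
    and le: "\<forall>\<epsilon>>0. \<epsilon> < b \<longrightarrow> \<bar>f \<epsilon>\<bar> \<le> c * \<bar>g \<epsilon>\<bar>"
    by (auto simp: bigo_def eventually_at_right_field)
  have "\<bar>f \<epsilon>\<bar> < (c + 1) * \<bar>g \<epsilon>\<bar>" if "0 < \<epsilon>" "\<epsilon> < b" for \<epsilon>
  proof -
    have "\<bar>f \<epsilon>\<bar> \<le> c * \<bar>g \<epsilon>\<bar>" using le that by blast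
    moreover have "\<bar>g \<epsilon>\<bar> > 0" using assms that by simp
    ultimately show ?thesis by (simp add: distrib_right)
  qed
  then show "\<exists>C>0. \<exists>\<epsilon>0>0. \<forall>\<epsilon>. 0 < \<epsilon> \<and> \<epsilon> < \<epsilon>0 \<longrightarrow> \<bar>f \<epsilon>\<bar> < C * \<bar>g \<epsilon>\<bar>"
    using c b by (intro exI[of _ "c + 1"] conjI exI[of _ b]) auto
next
  assume "\<exists>C>0. \<exists>\<epsilon>0>0. \<forall>\<epsilon>. 0 < \<epsilon> \<and> \<epsilon> < \<epsilon>0 \<longrightarrow> \<bar>f \<epsilon>\<bar> < C * \<bar>g \<epsilon>\<bar>"
  then obtain C b where "b > 0" "\<forall>\<epsilon>. 0 < \<epsilon> \<and> \<epsilon> < b \<longrightarrow> \<bar>f \<epsilon>\<bar> < C * \<bar>g \<epsilon>\<bar>"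
    by blast
  then have "eventually (\<lambda>\<epsilon>. norm (f \<epsilon>) \<le> C * norm (g \<epsilon>)) (at_right 0)"
    unfolding eventually_at_right_field by (intro exI[of _ b]) (auto intro: less_imp_le)
  then show "f \<in> O[at_right 0](g)" by (rule bigoI)
qed

(* A function A_0 -> R is represented by its extension with the value undefined outside A_0
   (extensional), so that functions are equal iff they agree on A_0. *)
definition moderate :: "((real ^ 'n \<Rightarrow> complex) \<Rightarrow> real) set" where
  "moderate = {r \<in> extensional (mollifiers 0).
     \<exists>N\<ge>1. \<forall>\<phi>\<in>mollifiers N.
       (\<lambda>\<epsilon>. \<bar>r (dilation \<epsilon> \<phi>)\<bar>) \<in> O[at_right 0](\<lambda>\<epsilon>. \<epsilon> powi (- int N))}"

definition negligible :: "((real ^ 'n \<Rightarrow> complex) \<Rightarrow> real) set" where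
  "negligible = {r \<in> extensional (mollifiers 0).
     \<forall>m\<ge>1. \<exists>q\<ge>1. \<forall>\<phi>\<in>mollifiers q.
       (\<lambda>\<epsilon>. \<bar>r (dilation \<epsilon> \<phi>)\<bar>) \<in> O[at_right 0](\<lambda>\<epsilon>. \<epsilon> ^ m)}"

definition moderate_ring :: "((real ^ 'n \<Rightarrow> complex) \<Rightarrow> real) ring" where
  "moderate_ring =
    \<lparr> carrier = moderate,
      mult = (\<lambda>r s. \<lambda>\<phi>\<in>mollifiers 0. r \<phi> * s \<phi>),
      one = (\<lambda>\<phi>\<in>mollifiers 0. 1),
      zero = (\<lambda>\<phi>\<in>mollifiers 0. 0),
      add = (\<lambda>r s. \<lambda>\<phi>\<in>mollifiers 0. r \<phi> + s \<phi>) \<rparr>"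

definition generalized_reals :: "'n::finite itself \<Rightarrow> ((real ^ 'n \<Rightarrow> complex) \<Rightarrow> real) set ring"
  where "generalized_reals _ = moderate_ring Quot negligible"

(* The elements of the quotient are cosets, so the representatives of a class are its members. *)
definition gen_le ::
  "((real ^ 'n \<Rightarrow> complex) \<Rightarrow> real) set \<Rightarrow> ((real ^ 'n \<Rightarrow> complex) \<Rightarrow> real) set \<Rightarrow> bool" where
  "gen_le u v \<longleftrightarrow> (\<exists>r\<in>u. \<exists>s\<in>v. \<forall>\<phi>\<in>mollifiers 0. r \<phi> \<le> s \<phi>)"

end

theory Submission
  imports Defs
begin

text \<open>
  The moderate functions form a commutative ring and the negligible ones an ideal in it, because
  the growth exponent along \<open>\<epsilon> \<mapsto> S\<^sub>\<epsilon>\<phi>\<close> behaves like a valuation: it adds up under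
  products and drops at most to the minimum under sums. This gives the ring.

  For the order, the existential over representatives collapses to a single negligible error
  (\<open>gen_le_class_iff\<close>): the class of \<open>r\<close> lies below that of \<open>s\<close> iff \<open>r \<le> s + n\<close> pointwise
  for some negligible \<open>n\<close>. Errors add up in a chain, whence transitivity, and the ideal property
  absorbs the mixed terms of \<open>(r + m) (s + n) \<ge> 0\<close>, whence compatibility with products.
  The delicate point is antisymmetry: \<open>r \<le> s + m\<close> and \<open>s \<le> r + n\<close> only bound \<open>r - s\<close> between
  two negligible functions. It holds since the ideal is order convex: negligibility is a bound on
  absolute values, so it passes to dominated functions (\<open>negligible_dominated\<close>).
\<close>

section \<open>Dilations of mollifiers\<close>

text \<open>
  The constant \<open>c\<close> makes the statement inductive: each partial derivative of the rescaled function
  is again a rescaled function, with constant \<open>c * a\<close>.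
\<close>

lemma C_k_scale:
  fixes f :: "real ^ 'n \<Rightarrow> complex"
  assumes "C_k k f"
  shows "C_k k (\<lambda>y. c * f (a *\<^sub>R y))"
  using assms
proof (induction k arbitrary: f c)
  case 0
  have "continuous_on UNIV (f \<circ> (\<lambda>y. a *\<^sub>R y))"
    using 0 by (intro continuous_on_compose continuous_intros) (auto intro: continuous_on_subset)
  then show ?case
    by (auto intro!: continuous_intros simp: o_def)
next
  case (Suc k)
  have deriv: "((\<lambda>y. c * f (a *\<^sub>R y)) has_derivative
      (\<lambda>h. c * frechet_derivative f (at (a *\<^sub>R x)) (a *\<^sub>R h))) (at x)" for x
  proof -
    have "(f has_derivative frechet_derivative f (at (a *\<^sub>R x))) (at (a *\<^sub>R x))"
      using Suc.prems by (simp add: frechet_derivative_works)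
    then have "((f \<circ> (\<lambda>y. a *\<^sub>R y)) has_derivative
        (frechet_derivative f (at (a *\<^sub>R x)) \<circ> (\<lambda>h. a *\<^sub>R h))) (at x)"
      by (intro diff_chain_at) (auto intro!: derivative_eq_intros)
    then show ?thesis
      by (auto simp: o_def intro!: has_derivative_mult_right)
  qed
  have partial: "frechet_derivative (\<lambda>y. c * f (a *\<^sub>R y)) (at x) (axis i 1) =
      (c * of_real a) * frechet_derivative f (at (a *\<^sub>R x)) (axis i 1)" for x i
  proof -
    have "linear (frechet_derivative f (at (a *\<^sub>R x)))"
      using Suc.prems by (simp add: linear_frechet_derivative)
    then show ?thesis
      unfolding frechet_derivative_at[OF deriv, symmetric]
      by (simp add: linear_scale scaleR_conv_of_real[where 'a = complex])
  qed
  have "C_k k (\<lambda>x. frechet_derivative (\<lambda>y. c * f (a *\<^sub>R y)) (at x) (axis i 1))" for i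
    unfolding partial using Suc.prems
    by (intro Suc.IH[of "\<lambda>x. frechet_derivative f (at x) (axis i 1)"]) simp
  then show ?case
    using deriv by (auto simp: differentiable_def)
qed

lemma dilation_in_test_functions:
  fixes \<phi> :: "real ^ 'n \<Rightarrow> complex"
  assumes "\<phi> \<in> test_functions" "\<epsilon> > 0"
  shows "dilation \<epsilon> \<phi> \<in> test_functions"
proof -
  have "{x. dilation \<epsilon> \<phi> x \<noteq> 0} = (\<lambda>x. \<epsilon> *\<^sub>R x) ` {x. \<phi> x \<noteq> 0}"
    using assms(2)
    by (auto simp: dilation_def image_iff intro!: exI[of _ "(1 / \<epsilon>) *\<^sub>R _"])
  then have "closure {x. dilation \<epsilon> \<phi> x \<noteq> 0} = (\<lambda>x. \<epsilon> *\<^sub>R x) ` closure {x. \<phi> x \<noteq> 0}"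
    by (simp add: closure_scaleR)
  moreover have "compact ((\<lambda>x. \<epsilon> *\<^sub>R x) ` closure {x. \<phi> x \<noteq> 0})"
    using assms(1) by (intro compact_scaling) (simp add: test_functions_def)
  moreover have "C_k k (dilation \<epsilon> \<phi>)" for k
    unfolding dilation_def using assms(1) by (intro C_k_scale) (simp add: test_functions_def)
  ultimately show ?thesis
    by (simp add: test_functions_def del: compact_closure)
qed

text \<open>
  The Jacobian \<open>\<epsilon> ^ n\<close> of the substitution \<open>x = \<epsilon> y\<close> cancels the factor in the dilation.
\<close>

lemma integral_dilation:
  fixes \<phi> :: "real ^ 'n \<Rightarrow> complex"
  assumes [measurable]: "\<phi> \<in> borel_measurable borel" and "\<epsilon> > 0"
  shows "(LINT x|lborel. dilation \<epsilon> \<phi> x) = (LINT x|lborel. \<phi> x)"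
proof -
  have "(LINT x|lborel. \<phi> x) = (LINT x|density (distr lborel borel (\<lambda>x. 0 + (1 / \<epsilon>) *\<^sub>R x))
      (\<lambda>_. ennreal (\<bar>1 / \<epsilon>\<bar> ^ DIM(real ^ 'n))). \<phi> x)"
    using assms(2) by (subst lborel_affine[of "1 / \<epsilon>" 0]) (simp_all add: ennreal_power)
  also have "\<dots> = (LINT x|lborel. dilation \<epsilon> \<phi> x)"
    using assms(2)
    by (subst integral_density, simp, simp, simp, subst integral_distr)
      (simp_all add: dilation_def scaleR_conv_of_real[where 'a = complex] power_divide)
  finally show ?thesis ..
qed

text \<open>
  Ring operations and pointwise inequalities are meaningful only on \<open>mollifiers 0\<close>, whereas the
  growth conditions look at \<open>r (dilation \<epsilon> \<phi>)\<close>. Stability under dilation connects the two: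
  otherwise even the zero function could take its default value along a dilation.
\<close>

lemma dilation_in_mollifiers:
  fixes \<phi> :: "real ^ 'n \<Rightarrow> complex"
  assumes "\<phi> \<in> mollifiers 0" "\<epsilon> > 0"
  shows "dilation \<epsilon> \<phi> \<in> mollifiers 0"
proof -
  have "\<phi> \<in> test_functions" and int: "(LINT x|lborel. \<phi> x) = 1"
    using assms(1) by (auto simp: mollifiers_def)
  then have "continuous_on UNIV \<phi>"
    using C_k.simps(1)[of \<phi>] by (auto simp: test_functions_def)
  then have "(LINT x|lborel. dilation \<epsilon> \<phi> x) = 1"
    using integral_dilation[of \<phi> \<epsilon>] assms(2) int by (simp add: borel_measurable_continuous_onI)
  then show ?thesis
    using dilation_in_test_functions[OF \<open>\<phi> \<in> test_functions\<close> assms(2)]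
    by (auto simp: mollifiers_def)
qed

lemma mollifiers_antimono:
  assumes "p \<le> q"
  shows "mollifiers q \<subseteq> mollifiers p"
  using assms by (fastforce simp: mollifiers_def)

section \<open>Asymptotic order along dilations\<close>

text \<open>
  Both growth conditions are instances of one predicate with an integer exponent, so that closure
  of the ring and of the ideal follow from the same calculus of exponents. Here \<open>q\<close> is the order
  up to which the moments of the mollifier vanish.
\<close>

definition has_order :: "nat \<Rightarrow> int \<Rightarrow> ((real ^ 'n \<Rightarrow> complex) \<Rightarrow> real) \<Rightarrow> bool" where
  "has_order q k r \<longleftrightarrow>
     (\<forall>\<phi>\<in>mollifiers q. (\<lambda>\<epsilon>. r (dilation \<epsilon> \<phi>)) \<in> O[at_right 0](\<lambda>\<epsilon>. \<epsilon> powi k))"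

lemma moderate_iff:
  "r \<in> moderate \<longleftrightarrow> r \<in> extensional (mollifiers 0) \<and> (\<exists>N\<ge>1. has_order N (- int N) r)"
  by (simp add: moderate_def has_order_def)

lemma negligible_iff:
  "r \<in> negligible \<longleftrightarrow>
     r \<in> extensional (mollifiers 0) \<and> (\<forall>m\<ge>1. \<exists>q\<ge>1. has_order q (int m) r)"
  by (simp add: negligible_def has_order_def)

lemma powi_bigo_mono:
  assumes "k \<le> l"
  shows "(\<lambda>\<epsilon>::real. \<epsilon> powi l) \<in> O[at_right 0](\<lambda>\<epsilon>. \<epsilon> powi k)"
proof (rule bigoI[where c = 1])
  show "\<forall>\<^sub>F \<epsilon> in at_right 0. norm (\<epsilon> powi l :: real) \<le> 1 * norm (\<epsilon> powi k)"
    unfolding eventually_at_right_field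
    using assms by (intro exI[of _ 1]) (auto simp: power_int_abs power_int_decreasing)
qed

lemma has_order_mono:
  assumes "has_order p l r" "p \<le> q" "k \<le> l"
  shows "has_order q k r"
  unfolding has_order_def
proof
  fix \<phi> :: "real ^ 'a \<Rightarrow> complex"
  assume "\<phi> \<in> mollifiers q"
  then have "(\<lambda>\<epsilon>. r (dilation \<epsilon> \<phi>)) \<in> O[at_right 0](\<lambda>\<epsilon>. \<epsilon> powi l)"
    using assms(1) mollifiers_antimono[OF assms(2)] by (auto simp: has_order_def)
  then show "(\<lambda>\<epsilon>. r (dilation \<epsilon> \<phi>)) \<in> O[at_right 0](\<lambda>\<epsilon>. \<epsilon> powi k)"
    using powi_bigo_mono[OF assms(3)] by (rule landau_o.big_trans)
qed

text \<open>
  Domination on \<open>mollifiers 0\<close> suffices, since dilations stay there. This is the source of the order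
  convexity of the ideal, and it also shows that cutting a function off outside \<open>mollifiers 0\<close>
  leaves its order unchanged.
\<close>

lemma has_order_dominated:
  fixes r :: "(real ^ 'n \<Rightarrow> complex) \<Rightarrow> real"
  assumes "has_order q k s" "\<And>\<phi>. \<phi> \<in> mollifiers 0 \<Longrightarrow> \<bar>r \<phi>\<bar> \<le> \<bar>s \<phi>\<bar>"
  shows "has_order q k r"
  unfolding has_order_def
proof
  fix \<phi> :: "real ^ 'n \<Rightarrow> complex"
  assume "\<phi> \<in> mollifiers q"
  then have "\<phi> \<in> mollifiers 0"
    using mollifiers_antimono[of 0 q] by auto
  then have "(\<lambda>\<epsilon>. r (dilation \<epsilon> \<phi>)) \<in> O[at_right 0](\<lambda>\<epsilon>. s (dilation \<epsilon> \<phi>))"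
    by (intro bigoI[where c = 1])
      (auto simp: eventually_at_right_field intro!: exI[of _ 1] assms(2) dilation_in_mollifiers)
  also have "(\<lambda>\<epsilon>. s (dilation \<epsilon> \<phi>)) \<in> O[at_right 0](\<lambda>\<epsilon>. \<epsilon> powi k)"
    using assms(1) \<open>\<phi> \<in> mollifiers q\<close> by (simp add: has_order_def)
  finally show "(\<lambda>\<epsilon>. r (dilation \<epsilon> \<phi>)) \<in> O[at_right 0](\<lambda>\<epsilon>. \<epsilon> powi k)" .
qed

lemma has_order_restrict:
  "has_order q k r \<Longrightarrow> has_order q k (restrict r (mollifiers 0))"
  by (erule has_order_dominated) simp

lemma has_order_add:
  "has_order q k r \<Longrightarrow> has_order q k s \<Longrightarrow> has_order q k (\<lambda>\<phi>. r \<phi> + s \<phi>)"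
  by (simp add: has_order_def sum_in_bigo)

lemma has_order_mult:
  assumes "has_order q k r" "has_order q l s"
  shows "has_order q (k + l) (\<lambda>\<phi>. r \<phi> * s \<phi>)"
  unfolding has_order_def
proof
  fix \<phi> :: "real ^ 'a \<Rightarrow> complex"
  assume "\<phi> \<in> mollifiers q"
  then have "(\<lambda>\<epsilon>. r (dilation \<epsilon> \<phi>) * s (dilation \<epsilon> \<phi>))
      \<in> O[at_right 0](\<lambda>\<epsilon>. \<epsilon> powi k * \<epsilon> powi l)"
    using assms by (intro landau_o.big.mult) (auto simp: has_order_def)
  also have "(\<lambda>\<epsilon>::real. \<epsilon> powi k * \<epsilon> powi l) \<in> O[at_right 0](\<lambda>\<epsilon>. \<epsilon> powi (k + l))"
    by (intro bigoI[where c = 1])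
      (auto simp: eventually_at_right_field power_int_add intro!: exI[of _ 1])
  finally show "(\<lambda>\<epsilon>. r (dilation \<epsilon> \<phi>) * s (dilation \<epsilon> \<phi>))
      \<in> O[at_right 0](\<lambda>\<epsilon>. \<epsilon> powi (k + l))" .
qed

lemma has_order_const: "has_order q 0 (\<lambda>_. c)"
  by (simp add: has_order_def)

section \<open>The moderate ring and its negligible ideal\<close>

lemma moderate_restrict_const: "(\<lambda>\<phi>\<in>mollifiers 0. c) \<in> moderate"
  unfolding moderate_iff
  by (auto intro!: exI[of _ 1] has_order_restrict has_order_mono[OF has_order_const])

lemma moderate_add:
  assumes "r \<in> moderate" "s \<in> moderate"
  shows "(\<lambda>\<phi>\<in>mollifiers 0. r \<phi> + s \<phi>) \<in> moderate"
proof -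
  obtain M N where "M \<ge> 1" "N \<ge> 1" and "has_order M (- int M) r" "has_order N (- int N) s"
    using assms by (auto simp: moderate_iff)
  then have "has_order (max M N) (- int (max M N)) (\<lambda>\<phi>. r \<phi> + s \<phi>)"
    by (intro has_order_add) (auto elim: has_order_mono)
  then show ?thesis
    using \<open>M \<ge> 1\<close> unfolding moderate_iff
    by (auto intro!: exI[of _ "max M N"] has_order_restrict)
qed

lemma moderate_mult:
  assumes "r \<in> moderate" "s \<in> moderate"
  shows "(\<lambda>\<phi>\<in>mollifiers 0. r \<phi> * s \<phi>) \<in> moderate"
proof -
  obtain M N where "M \<ge> 1" "N \<ge> 1" and "has_order M (- int M) r" "has_order N (- int N) s"
    using assms by (auto simp: moderate_iff)
  then have "has_order (M + N) (- int M + - int N) (\<lambda>\<phi>. r \<phi> * s \<phi>)"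
    by (intro has_order_mult) (auto elim: has_order_mono)
  then show ?thesis
    using \<open>M \<ge> 1\<close> unfolding moderate_iff
    by (auto intro!: exI[of _ "M + N"] has_order_restrict)
qed

lemma negligible_add:
  assumes "r \<in> negligible" "s \<in> negligible"
  shows "(\<lambda>\<phi>\<in>mollifiers 0. r \<phi> + s \<phi>) \<in> negligible"
  unfolding negligible_iff
proof (intro conjI allI impI)
  fix m :: nat assume "m \<ge> 1"
  then obtain p q where "p \<ge> 1" "has_order p (int m) r" "has_order q (int m) s"
    using assms unfolding negligible_iff by meson
  then have "has_order (max p q) (int m) (\<lambda>\<phi>. r \<phi> + s \<phi>)"
    by (intro has_order_add) (auto elim: has_order_mono)
  then show "\<exists>q\<ge>1. has_order q (int m) (\<lambda>\<phi>\<in>mollifiers 0. r \<phi> + s \<phi>)"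
    using \<open>p \<ge> 1\<close> by (intro exI[of _ "max p q"]) (auto intro: has_order_restrict)
qed auto

text \<open>
  A moderate factor loses a fixed power \<open>\<epsilon> ^ N\<close>; negligibility with exponent \<open>m + N\<close> makes up
  for it.
\<close>

lemma negligible_mult_moderate:
  assumes "r \<in> negligible" "s \<in> moderate"
  shows "(\<lambda>\<phi>\<in>mollifiers 0. r \<phi> * s \<phi>) \<in> negligible"
  unfolding negligible_iff
proof (intro conjI allI impI)
  obtain N where "N \<ge> 1" "has_order N (- int N) s"
    using assms(2) by (auto simp: moderate_iff)
  fix m :: nat
  obtain q where "q \<ge> 1" "has_order q (int (m + N)) r"
    using assms(1) \<open>N \<ge> 1\<close> unfolding negligible_iff by (meson trans_le_add2)
  then have "has_order (max q N) (int (m + N) + - int N) (\<lambda>\<phi>. r \<phi> * s \<phi>)"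
    using \<open>has_order N (- int N) s\<close> by (intro has_order_mult) (auto elim: has_order_mono)
  then show "\<exists>q\<ge>1. has_order q (int m) (\<lambda>\<phi>\<in>mollifiers 0. r \<phi> * s \<phi>)"
    using \<open>q \<ge> 1\<close> by (intro exI[of _ "max q N"]) (auto intro: has_order_restrict)
qed auto

lemma negligible_subset_moderate: "negligible \<subseteq> moderate"
proof
  fix r :: "(real ^ 'n \<Rightarrow> complex) \<Rightarrow> real"
  assume r: "r \<in> negligible"
  then obtain q where "q \<ge> 1" "has_order q (int 1) r"
    unfolding negligible_iff by blast
  then have "has_order q (- int q) r"
    by (auto elim: has_order_mono)
  then show "r \<in> moderate"
    using r \<open>q \<ge> 1\<close> by (auto simp: moderate_iff negligible_iff)
qed

lemma negligible_dominated:
  assumes "s \<in> negligible" "r \<in> extensional (mollifiers 0)"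
    and "\<And>\<phi>. \<phi> \<in> mollifiers 0 \<Longrightarrow> \<bar>r \<phi>\<bar> \<le> \<bar>s \<phi>\<bar>"
  shows "r \<in> negligible"
  using assms has_order_dominated[of _ _ s r] unfolding negligible_iff by meson

lemma negligible_zero: "(\<lambda>\<phi>\<in>mollifiers 0. 0) \<in> negligible"
proof -
  have "has_order 1 k (\<lambda>\<phi>\<in>mollifiers 0. 0)" for k
    by (rule has_order_restrict) (simp add: has_order_def)
  then show ?thesis
    unfolding negligible_iff by auto
qed

lemma negligible_uminus:
  "r \<in> negligible \<Longrightarrow> (\<lambda>\<phi>\<in>mollifiers 0. - r \<phi>) \<in> negligible"
  by (erule negligible_dominated) auto

lemma negligible_abs:
  "r \<in> negligible \<Longrightarrow> (\<lambda>\<phi>\<in>mollifiers 0. \<bar>r \<phi>\<bar>) \<in> negligible"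
  by (erule negligible_dominated) auto

lemma moderate_uminus:
  "r \<in> moderate \<Longrightarrow> (\<lambda>\<phi>\<in>mollifiers 0. - r \<phi>) \<in> moderate"
  using moderate_mult[OF moderate_restrict_const[of "-1"], of r]
  by (simp cong: restrict_cong)

lemma moderate_extensional: "r \<in> moderate \<Longrightarrow> r \<in> extensional (mollifiers 0)"
  by (simp add: moderate_iff)

lemma moderate_restrict: "r \<in> moderate \<Longrightarrow> restrict r (mollifiers 0) = r"
  by (simp add: moderate_extensional extensional_restrict)

lemma moderate_ring_sel:
  "carrier moderate_ring = moderate"
  "r \<otimes>\<^bsub>moderate_ring\<^esub> s = (\<lambda>\<phi>\<in>mollifiers 0. r \<phi> * s \<phi>)"
  "\<one>\<^bsub>moderate_ring\<^esub> = (\<lambda>\<phi>\<in>mollifiers 0. 1)"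
  "r \<oplus>\<^bsub>moderate_ring\<^esub> s = (\<lambda>\<phi>\<in>mollifiers 0. r \<phi> + s \<phi>)"
  "\<zero>\<^bsub>moderate_ring\<^esub> = (\<lambda>\<phi>\<in>mollifiers 0. 0)"
  by (simp_all add: moderate_ring_def)

lemma moderate_ring_cring: "cring (moderate_ring :: ((real ^ 'n \<Rightarrow> complex) \<Rightarrow> real) ring)"
proof (rule cringI)
  show "abelian_group (moderate_ring :: ((real ^ 'n \<Rightarrow> complex) \<Rightarrow> real) ring)"
  proof (rule abelian_groupI)
    fix r :: "(real ^ 'n \<Rightarrow> complex) \<Rightarrow> real"
    assume "r \<in> carrier moderate_ring"
    then show "\<exists>s\<in>carrier moderate_ring. s \<oplus>\<^bsub>moderate_ring\<^esub> r = \<zero>\<^bsub>moderate_ring\<^esub>"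
      by (intro bexI[of _ "\<lambda>\<phi>\<in>mollifiers 0. - r \<phi>"])
        (simp_all add: moderate_ring_sel moderate_uminus cong: restrict_cong)
  qed (simp_all add: moderate_ring_sel moderate_add moderate_restrict_const
      moderate_restrict add_ac cong: restrict_cong)
  show "comm_monoid (moderate_ring :: ((real ^ 'n \<Rightarrow> complex) \<Rightarrow> real) ring)"
    by (rule comm_monoidI)
      (simp_all add: moderate_ring_sel moderate_mult moderate_restrict_const
        moderate_restrict mult_ac cong: restrict_cong)
qed (simp add: moderate_ring_sel distrib_right cong: restrict_cong)

lemma negligible_ideal:
  "ideal negligible (moderate_ring :: ((real ^ 'n \<Rightarrow> complex) \<Rightarrow> real) ring)"
proof -
  interpret cring "moderate_ring :: ((real ^ 'n \<Rightarrow> complex) \<Rightarrow> real) ring"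
    by (rule moderate_ring_cring)
  show ?thesis
  proof (rule idealI)
    show "ring (moderate_ring :: ((real ^ 'n \<Rightarrow> complex) \<Rightarrow> real) ring)" ..
    have uminus: "\<ominus>\<^bsub>moderate_ring\<^esub> r = (\<lambda>\<phi>\<in>mollifiers 0. - r \<phi>)" if "r \<in> moderate"
      for r :: "(real ^ 'n \<Rightarrow> complex) \<Rightarrow> real"
      using that
      by (intro minus_equality)
        (simp_all add: moderate_ring_sel moderate_uminus cong: restrict_cong)
    show "subgroup negligible (add_monoid (moderate_ring :: ((real ^ 'n \<Rightarrow> complex) \<Rightarrow> real) ring))"
      using negligible_subset_moderate negligible_zero
      by (intro add.subgroupI)
        (auto simp: moderate_ring_sel(1,4) negligible_add uminus negligible_uminus subset_iff)
  next
    fix r s :: "(real ^ 'n \<Rightarrow> complex) \<Rightarrow> real"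
    assume "r \<in> negligible" "s \<in> carrier moderate_ring"
    then show rs: "r \<otimes>\<^bsub>moderate_ring\<^esub> s \<in> negligible"
      by (simp add: moderate_ring_sel negligible_mult_moderate)
    then show "s \<otimes>\<^bsub>moderate_ring\<^esub> r \<in> negligible"
      by (simp add: moderate_ring_sel mult.commute)
  qed
qed

section \<open>The order on cosets\<close>

abbreviation gen_class ::
  "((real ^ 'n \<Rightarrow> complex) \<Rightarrow> real) \<Rightarrow> ((real ^ 'n \<Rightarrow> complex) \<Rightarrow> real) set" where
  "gen_class r \<equiv> negligible +>\<^bsub>moderate_ring\<^esub> r"

text \<open>
  The errors in the two representatives are merged into one, on the right. After this no choice of
  representatives is left, and inequalities between fixed functions can be chained.
\<close>

lemma gen_le_class_iff:
  "gen_le (gen_class r) (gen_class s) \<longleftrightarrow>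
    (\<exists>n\<in>negligible. \<forall>\<phi>\<in>mollifiers 0. r \<phi> \<le> s \<phi> + n \<phi>)"
proof
  assume "gen_le (gen_class r) (gen_class s)"
  then obtain a b where "a \<in> negligible" "b \<in> negligible"
    and "\<forall>\<phi>\<in>mollifiers 0. a \<phi> + r \<phi> \<le> b \<phi> + s \<phi>"
    by (auto simp: gen_le_def a_r_coset_def' moderate_ring_sel)
  then show "\<exists>n\<in>negligible. \<forall>\<phi>\<in>mollifiers 0. r \<phi> \<le> s \<phi> + n \<phi>"
    by (intro bexI[of _ "\<lambda>\<phi>\<in>mollifiers 0. b \<phi> + (\<lambda>\<phi>\<in>mollifiers 0. - a \<phi>) \<phi>"]
        negligible_add negligible_uminus) auto
next
  assume "\<exists>n\<in>negligible. \<forall>\<phi>\<in>mollifiers 0. r \<phi> \<le> s \<phi> + n \<phi>"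
  then obtain n where "n \<in> negligible" and le: "\<forall>\<phi>\<in>mollifiers 0. r \<phi> \<le> s \<phi> + n \<phi>"
    by blast
  then have "(\<lambda>\<phi>\<in>mollifiers 0. n \<phi> + s \<phi>) \<in> gen_class s"
    by (auto simp: a_r_coset_def' moderate_ring_sel)
  moreover have "(\<lambda>\<phi>\<in>mollifiers 0. (\<lambda>\<phi>\<in>mollifiers 0. 0) \<phi> + r \<phi>) \<in> gen_class r"
    using negligible_zero unfolding a_r_coset_def' moderate_ring_sel by blast
  ultimately show "gen_le (gen_class r) (gen_class s)"
    using le unfolding gen_le_def by (elim bexI[rotated]) (simp add: add.commute)
qed

lemma gen_class_eqI:
  assumes "r \<in> moderate" "s \<in> moderate" "n \<in> negligible"
    and "\<And>\<phi>. \<phi> \<in> mollifiers 0 \<Longrightarrow> \<bar>r \<phi> - s \<phi>\<bar> \<le> \<bar>n \<phi>\<bar>"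
  shows "gen_class r = gen_class s"
proof -
  interpret ideal negligible "moderate_ring :: ((real ^ 'a \<Rightarrow> complex) \<Rightarrow> real) ring"
    by (rule negligible_ideal)
  have "(\<lambda>\<phi>\<in>mollifiers 0. r \<phi> - s \<phi>) \<in> negligible"
    by (rule negligible_dominated[OF assms(3)]) (auto simp: assms(4))
  moreover have "r = (\<lambda>\<phi>\<in>mollifiers 0. r \<phi> - s \<phi>) \<oplus>\<^bsub>moderate_ring\<^esub> s"
    using moderate_restrict[OF assms(1)]
    by (simp add: moderate_ring_sel cong: restrict_cong)
  ultimately have "r \<in> gen_class s"
    by (auto simp: a_r_coset_def')
  moreover have "s \<in> carrier moderate_ring"
    using assms(2) by (simp add: moderate_ring_sel)
  ultimately show ?thesis
    using a_subgroup a_repr_independence by metis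
qed

lemma gen_le_refl: "gen_le (gen_class r) (gen_class r)"
  unfolding gen_le_class_iff by (rule bexI[OF _ negligible_zero]) simp

lemma gen_le_trans:
  assumes "gen_le (gen_class r) (gen_class s)" "gen_le (gen_class s) (gen_class t)"
  shows "gen_le (gen_class r) (gen_class t)"
proof -
  obtain m n where "m \<in> negligible" "n \<in> negligible"
    and le: "\<And>\<phi>. \<phi> \<in> mollifiers 0 \<Longrightarrow> r \<phi> \<le> s \<phi> + m \<phi>"
      "\<And>\<phi>. \<phi> \<in> mollifiers 0 \<Longrightarrow> s \<phi> \<le> t \<phi> + n \<phi>"
    using assms unfolding gen_le_class_iff by blast
  have "r \<phi> \<le> t \<phi> + (m \<phi> + n \<phi>)" if "\<phi> \<in> mollifiers 0" for \<phi>
    using le[OF that] by linarith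
  then show ?thesis
    unfolding gen_le_class_iff
    by (intro bexI[OF _ negligible_add[OF \<open>m \<in> negligible\<close> \<open>n \<in> negligible\<close>]]) simp
qed

lemma gen_le_antisym:
  assumes "r \<in> moderate" "s \<in> moderate"
    and "gen_le (gen_class r) (gen_class s)" "gen_le (gen_class s) (gen_class r)"
  shows "gen_class r = gen_class s"
proof -
  obtain m n where mn: "m \<in> negligible" "n \<in> negligible"
    and le: "\<And>\<phi>. \<phi> \<in> mollifiers 0 \<Longrightarrow> r \<phi> \<le> s \<phi> + m \<phi>"
      "\<And>\<phi>. \<phi> \<in> mollifiers 0 \<Longrightarrow> s \<phi> \<le> r \<phi> + n \<phi>"
    using assms(3,4) unfolding gen_le_class_iff by blast
  \<comment> \<open>\<open>m\<close> and \<open>n\<close> are one-sided bounds for \<open>r - s\<close> and \<open>s - r\<close>, of no definite sign;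
    the sum of their absolute values bounds both differences.\<close>
  define bound where
    "bound = (\<lambda>\<phi>\<in>mollifiers 0. (\<lambda>\<phi>\<in>mollifiers 0. \<bar>m \<phi>\<bar>) \<phi> + (\<lambda>\<phi>\<in>mollifiers 0. \<bar>n \<phi>\<bar>) \<phi>)"
  have "bound \<in> negligible"
    unfolding bound_def
    by (intro negligible_add negligible_abs mn)
  then show ?thesis
  proof (rule gen_class_eqI[OF assms(1,2)])
    fix \<phi> :: "real ^ 'a \<Rightarrow> complex"
    assume "\<phi> \<in> mollifiers 0"
    then show "\<bar>r \<phi> - s \<phi>\<bar> \<le> \<bar>bound \<phi>\<bar>"
      using le[of \<phi>] by (auto simp: bound_def)
  qed
qed

lemma gen_le_add:
  assumes "gen_le (gen_class r) (gen_class s)"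
  shows "gen_le (gen_class (r \<oplus>\<^bsub>moderate_ring\<^esub> t)) (gen_class (s \<oplus>\<^bsub>moderate_ring\<^esub> t))"
proof -
  obtain n where "n \<in> negligible" "\<forall>\<phi>\<in>mollifiers 0. r \<phi> \<le> s \<phi> + n \<phi>"
    using assms unfolding gen_le_class_iff by blast
  then show ?thesis
    unfolding gen_le_class_iff by (intro bexI[of _ n]) (simp_all add: moderate_ring_sel)
qed

lemma gen_le_mult:
  assumes "r \<in> moderate" "s \<in> moderate"
    and "gen_le (gen_class \<zero>\<^bsub>moderate_ring\<^esub>) (gen_class r)"
    and "gen_le (gen_class \<zero>\<^bsub>moderate_ring\<^esub>) (gen_class s)"
  shows "gen_le (gen_class \<zero>\<^bsub>moderate_ring\<^esub>) (gen_class (r \<otimes>\<^bsub>moderate_ring\<^esub> s))"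
proof -
  obtain m n where mn: "m \<in> negligible" "n \<in> negligible"
    and nonneg: "\<And>\<phi>. \<phi> \<in> mollifiers 0 \<Longrightarrow> 0 \<le> r \<phi> + m \<phi>"
      "\<And>\<phi>. \<phi> \<in> mollifiers 0 \<Longrightarrow> 0 \<le> s \<phi> + n \<phi>"
    using assms(3,4) unfolding gen_le_class_iff by (auto simp: moderate_ring_sel)
  \<comment> \<open>\<open>(r + m)(s + n) = rs + (m(s + n) + nr)\<close>, and the last bracket lies in the ideal.\<close>
  define e where "e = (\<lambda>\<phi>\<in>mollifiers 0.
    (\<lambda>\<phi>\<in>mollifiers 0. m \<phi> * (\<lambda>\<phi>\<in>mollifiers 0. s \<phi> + n \<phi>) \<phi>) \<phi> +
    (\<lambda>\<phi>\<in>mollifiers 0. n \<phi> * r \<phi>) \<phi>)"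
  have "e \<in> negligible"
    unfolding e_def using mn assms(1,2) negligible_subset_moderate
    by (intro negligible_add negligible_mult_moderate moderate_add) auto
  moreover have "0 \<le> r \<phi> * s \<phi> + e \<phi>" if "\<phi> \<in> mollifiers 0" for \<phi>
    using mult_nonneg_nonneg[OF nonneg[OF that]] that by (simp add: e_def algebra_simps)
  ultimately show ?thesis
    unfolding gen_le_class_iff by (intro bexI[of _ e]) (auto simp: moderate_ring_sel)
qed

theorem proposition17:
  fixes R :: "((real ^ 'n \<Rightarrow> complex) \<Rightarrow> real) set ring" (structure)
  defines "R \<equiv> generalized_reals TYPE('n)"
  shows "cring R \<and>
    partial_order_on (carrier R) {(r, s). r \<in> carrier R \<and> s \<in> carrier R \<and> gen_le r s} \<and>
    (\<forall>r\<in>carrier R. \<forall>s\<in>carrier R. \<forall>t\<in>carrier R. gen_le r s \<longrightarrow> gen_le (r \<oplus> t) (s \<oplus> t)) \<and>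
    (\<forall>r\<in>carrier R. \<forall>s\<in>carrier R. gen_le \<zero> r \<longrightarrow> gen_le \<zero> s \<longrightarrow> gen_le \<zero> (r \<otimes> s))"
proof -
  let ?M = "moderate_ring :: ((real ^ 'n \<Rightarrow> complex) \<Rightarrow> real) ring"
  interpret ideal negligible ?M
    by (rule negligible_ideal)
  interpret hom: ring_hom_ring ?M R gen_class
    unfolding R_def generalized_reals_def by (rule rcos_ring_hom_ring)
  have carrier: "carrier R = gen_class ` moderate"
    unfolding R_def generalized_reals_def FactRing_def A_RCOSETS_def'
    by (auto simp: moderate_ring_sel)
  have ring_ops: "gen_class r \<oplus> gen_class s = gen_class (r \<oplus>\<^bsub>?M\<^esub> s)"
    "gen_class r \<otimes> gen_class s = gen_class (r \<otimes>\<^bsub>?M\<^esub> s)" if "r \<in> moderate" "s \<in> moderate" for r s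
    using that by (simp_all add: moderate_ring_sel(1))
  have zero: "\<zero> = gen_class \<zero>\<^bsub>?M\<^esub>"
    by simp
  have "cring R"
    unfolding R_def generalized_reals_def by (rule quotient_is_cring[OF moderate_ring_cring])
  moreover have
    "partial_order_on (carrier R) {(r, s). r \<in> carrier R \<and> s \<in> carrier R \<and> gen_le r s}"
    (is "partial_order_on _ ?le")
    unfolding partial_order_on_def preorder_on_def
  proof (intro conjI)
    show "?le \<subseteq> carrier R \<times> carrier R"
      by auto
    show "refl_on (carrier R) ?le"
      unfolding carrier by (auto simp: refl_on_def gen_le_refl)
    show "trans ?le"
    proof (rule transI)
      fix u v w assume uvw: "(u, v) \<in> ?le" "(v, w) \<in> ?le"
      then have "u \<in> carrier R" "v \<in> carrier R" "w \<in> carrier R"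
        by simp_all
      then obtain r s t where "u = gen_class r" "v = gen_class s" "w = gen_class t"
        unfolding carrier by (elim imageE)
      then have "gen_le u w"
        using uvw gen_le_trans[of r s t] by simp
      then show "(u, w) \<in> ?le"
        using uvw by simp
    qed
    show "antisym ?le"
    proof (rule antisymI)
      fix u v assume uv: "(u, v) \<in> ?le" "(v, u) \<in> ?le"
      then have "u \<in> carrier R" "v \<in> carrier R"
        by simp_all
      then obtain r s where "r \<in> moderate" "s \<in> moderate" "u = gen_class r" "v = gen_class s"
        unfolding carrier by (elim imageE)
      then show "u = v"
        using uv gen_le_antisym[of r s] by simp
    qed
  qed
  moreover have "\<forall>r\<in>carrier R. \<forall>s\<in>carrier R. \<forall>t\<in>carrier R.
      gen_le r s \<longrightarrow> gen_le (r \<oplus> t) (s \<oplus> t)"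
    unfolding carrier by (auto simp: ring_ops gen_le_add)
  moreover have "\<forall>r\<in>carrier R. \<forall>s\<in>carrier R.
      gen_le \<zero> r \<longrightarrow> gen_le \<zero> s \<longrightarrow> gen_le \<zero> (r \<otimes> s)"
    unfolding carrier zero by (auto simp: ring_ops gen_le_mult simp del: hom.hom_zero)
  ultimately show ?thesis
    by blast
qed

end
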